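(* Let $\alpha\in(0,1]$ and $1\le p<\infty$, and let $$L^{p,\alpha}(\mathbb R_+)=\Bigl\{f:\mathbb R_+\to\mathbb C\ \text{measurable}:\ \int_0^\infty|f(x)|^p\,x^{\alpha-1}\,dx<\infty\Bigr\}.$$ Define the operator $$(U_pf)(\xi):=\alpha^{-1/p}f(\xi^{1/\alpha}),\qquad \xi>0.$$ Then $U_p:L^{p,\alpha}(\mathbb R_+)\to L^p(0,\infty)$ is an isometric isomorphism. Its inverse is given by $$(U_p^{-1}g)(x)=\alpha^{1/p}g(x^\alpha),\qquad x>0.$$ Moreover, when $p=2$, the operator $U_2$ is unitary.
   Context: $\mathbb R_+=(0,\infty)$. Functions are identified when equal almost everywhere. $L^{p,\alpha}(\mathbb R_+)$ carries the norm $\|f\|_{p,\alpha}=\bigl(\int_0^\infty|f(x)|^p\,x^{\alpha-1}\,dx\bigr)^{1/p}$ (for $p=2$, the inner product of $L^2$ with respect to the measure $x^{\alpha-1}dx$), and $L^p(0,\infty)$ its usual norm with respect to Lebesgue measure. *)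

theory Defs
  imports "HOL-Analysis.Analysis"
begin

definition Lp_fun :: "real \<Rightarrow> real measure \<Rightarrow> (real \<Rightarrow> complex) set" where
  "Lp_fun p M = {f \<in> borel_measurable M. integrable M (\<lambda>x. cmod (f x) powr p)}"

definition ae_eq :: "real \<Rightarrow> real measure \<Rightarrow> (real \<Rightarrow> complex) rel" where
  "ae_eq p M = {(f, g). f \<in> Lp_fun p M \<and> g \<in> Lp_fun p M \<and> (AE x in M. f x = g x)}"

lemma equiv_ae_eq: "equiv (Lp_fun p M) (ae_eq p M)"
proof (rule equivI)
  show "ae_eq p M \<subseteq> Lp_fun p M \<times> Lp_fun p M"
    by (auto simp: ae_eq_def)
  show "refl_on (Lp_fun p M) (ae_eq p M)"
    by (auto simp: refl_on_def ae_eq_def)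
  show "sym (ae_eq p M)"
    by (auto simp: sym_def ae_eq_def eq_commute)
  show "trans (ae_eq p M)"
    by (force simp: trans_def ae_eq_def)
qed

definition Lp :: "real \<Rightarrow> real measure \<Rightarrow> (real \<Rightarrow> complex) set set" where
  "Lp p M = Lp_fun p M // ae_eq p M"

abbreviation Lp_class :: "real \<Rightarrow> real measure \<Rightarrow> (real \<Rightarrow> complex) \<Rightarrow> (real \<Rightarrow> complex) set" where
  "Lp_class p M f \<equiv> ae_eq p M `` {f}"

text \<open>
  Operations on classes are the usual lifts along the equivalence relation: a union over all
  representatives for class-valued operations, and the common value on all
  representatives for scalar-valued ones.
\<close>

definition Lp_add ::
    "real \<Rightarrow> real measure \<Rightarrow> (real \<Rightarrow> complex) set \<Rightarrow> (real \<Rightarrow> complex) set \<Rightarrow> (real \<Rightarrow> complex) set" where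
  "Lp_add p M F G = (\<Union>f\<in>F. \<Union>g\<in>G. Lp_class p M (\<lambda>x. f x + g x))"

definition Lp_scale ::
    "real \<Rightarrow> real measure \<Rightarrow> complex \<Rightarrow> (real \<Rightarrow> complex) set \<Rightarrow> (real \<Rightarrow> complex) set" where
  "Lp_scale p M c F = (\<Union>f\<in>F. Lp_class p M (\<lambda>x. c * f x))"

definition Lp_norm :: "real \<Rightarrow> real measure \<Rightarrow> (real \<Rightarrow> complex) set \<Rightarrow> real" where
  "Lp_norm p M F = the_elem ((\<lambda>f. (\<integral>x. cmod (f x) powr p \<partial>M) powr (1 / p)) ` F)"

definition L2_inner ::
    "real measure \<Rightarrow> (real \<Rightarrow> complex) set \<Rightarrow> (real \<Rightarrow> complex) set \<Rightarrow> complex" where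
  "L2_inner M F G = the_elem ((\<lambda>(f, g). \<integral>x. f x * cnj (g x) \<partial>M) ` (F \<times> G))"

definition Lp_linear ::
    "real \<Rightarrow> real measure \<Rightarrow> real measure \<Rightarrow> ((real \<Rightarrow> complex) set \<Rightarrow> (real \<Rightarrow> complex) set) \<Rightarrow> bool" where
  "Lp_linear p M N T \<longleftrightarrow>
     (\<forall>F\<in>Lp p M. T F \<in> Lp p N) \<and>
     (\<forall>F\<in>Lp p M. \<forall>G\<in>Lp p M. T (Lp_add p M F G) = Lp_add p N (T F) (T G)) \<and>
     (\<forall>c. \<forall>F\<in>Lp p M. T (Lp_scale p M c F) = Lp_scale p N c (T F))"

definition isometric_isomorphism ::
    "real \<Rightarrow> real measure \<Rightarrow> real measure \<Rightarrow> ((real \<Rightarrow> complex) set \<Rightarrow> (real \<Rightarrow> complex) set) \<Rightarrow> bool" where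
  "isometric_isomorphism p M N T \<longleftrightarrow>
     Lp_linear p M N T \<and> bij_betw T (Lp p M) (Lp p N) \<and>
     (\<forall>F\<in>Lp p M. Lp_norm p N (T F) = Lp_norm p M F)"

definition unitary ::
    "real measure \<Rightarrow> real measure \<Rightarrow> ((real \<Rightarrow> complex) set \<Rightarrow> (real \<Rightarrow> complex) set) \<Rightarrow> bool" where
  "unitary M N T \<longleftrightarrow>
     Lp_linear 2 M N T \<and> bij_betw T (Lp 2 M) (Lp 2 N) \<and>
     (\<forall>F\<in>Lp 2 M. \<forall>G\<in>Lp 2 M. L2_inner N (T F) (T G) = L2_inner M F G)"

text \<open>
  A function on the positive half-line is represented by a total function on the reals.
  Both measures below have space \<open>{0<..}\<close>, so measurability, integrals and the
  equivalence classes ignore the values at nonpositive arguments.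
\<close>

abbreviation leb_pos :: "real measure" where
  "leb_pos \<equiv> lebesgue_on {0<..}"

definition weighted :: "real \<Rightarrow> real measure" where
  "weighted \<alpha> = density leb_pos (\<lambda>x. ennreal (x powr (\<alpha> - 1)))"

definition U_fun :: "real \<Rightarrow> real \<Rightarrow> (real \<Rightarrow> complex) \<Rightarrow> real \<Rightarrow> complex" where
  "U_fun p \<alpha> f = (\<lambda>\<xi>. complex_of_real (\<alpha> powr (- 1 / p)) * f (\<xi> powr (1 / \<alpha>)))"

definition U :: "real \<Rightarrow> real \<Rightarrow> (real \<Rightarrow> complex) set \<Rightarrow> (real \<Rightarrow> complex) set" where
  "U p \<alpha> F = (\<Union>f\<in>F. Lp_class p leb_pos (U_fun p \<alpha> f))"

definition U_inv_fun :: "real \<Rightarrow> real \<Rightarrow> (real \<Rightarrow> complex) \<Rightarrow> real \<Rightarrow> complex" where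
  "U_inv_fun p \<alpha> g = (\<lambda>x. complex_of_real (\<alpha> powr (1 / p)) * g (x powr \<alpha>))"

end

theory Submission
  imports Defs
begin

text \<open>
  The map $x \mapsto x^\alpha$ pushes the measure $x^{\alpha-1}\,dx$ forward to
  $\alpha^{-1}\,d\xi$, by the change of variables formula applied to indicator functions.
  Hence integrals, null sets and measurability transfer between the two sides, and the
  factor $\alpha^{-1/p}$ in $U_p$ absorbs the constant $\alpha^{-1}$.
\<close>

section \<open>Power maps on the half-line and their measurability\<close>

lemma space_weighted [simp]: "space (weighted \<alpha>) = {0<..}"
  and sets_weighted [simp, measurable_cong]: "sets (weighted \<alpha>) = sets leb_pos"
  by (simp_all add: weighted_def)

text \<open>The target carries Borel sets here, which is what the weight needs as an integrand.
  Precomposing a Lebesgue measurable function with a power needs the stronger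
  \<open>powr_measurable_leb_pos\<close>.\<close>

lemma powr_borel_measurable_leb_pos [measurable]: "(\<lambda>x. x powr a) \<in> borel_measurable leb_pos"
proof -
  have "(\<lambda>x::real. x powr a) \<in> borel_measurable borel"
    by measurable
  then show ?thesis
    by (intro measurable_restrict_space1 measurable_completion) simp
qed

lemma inj_on_powr_pos: "a \<noteq> 0 \<Longrightarrow> inj_on (\<lambda>x::real. x powr a) {0<..}"
  by (rule inj_on_inverseI[where g = "\<lambda>x. x powr (1 / a)"]) (auto simp: powr_powr)

text \<open>Measurability concerns preimages, while the results on differentiable maps concern
  images. Passing to the inverse power translates one into the other.\<close>

lemma powr_vimage_pos_eq_image:
  fixes a :: real
  assumes "a \<noteq> 0" "B \<subseteq> {0<..}"
  shows "(\<lambda>x. x powr a) -` B \<inter> {0<..} = (\<lambda>x. x powr (1 / a)) ` B"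
proof (intro equalityI subsetI)
  fix x assume "x \<in> (\<lambda>x. x powr a) -` B \<inter> {0<..}"
  then show "x \<in> (\<lambda>x. x powr (1 / a)) ` B"
    using assms(1) by (intro image_eqI[of _ _ "x powr a"]) (auto simp: powr_powr)
next
  fix x assume "x \<in> (\<lambda>x. x powr (1 / a)) ` B"
  then show "x \<in> (\<lambda>x. x powr a) -` B \<inter> {0<..}"
    using assms by (auto simp: powr_powr subset_iff)
qed

text \<open>
  Continuity does not suffice here: preimages of Lebesgue null sets must be null, which holds
  because they are images under the differentiable inverse power.
\<close>

lemma powr_measurable_leb_pos:
  assumes "a \<noteq> 0"
  shows "(\<lambda>x. x powr a) \<in> measurable leb_pos leb_pos"
proof (rule measurableI)
  fix B assume "B \<in> sets leb_pos"
  then have B: "B \<in> sets lebesgue" "B \<subseteq> {0<..}"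
    by (auto simp: sets_restrict_space_iff)
  have "(\<lambda>x. x powr (1 / a)) differentiable_on B"
    unfolding differentiable_on_def
  proof
    fix x assume "x \<in> B"
    then have "((\<lambda>x. x powr (1 / a)) has_real_derivative (1 / a) * x powr (1 / a - 1)) (at x)"
      using B by (intro has_real_derivative_powr) auto
    then show "(\<lambda>x. x powr (1 / a)) differentiable at x within B"
      using differentiable_at_withinI real_differentiable_def by blast
  qed
  then have "(\<lambda>x. x powr (1 / a)) ` B \<in> sets lebesgue"
    by (intro differentiable_image_in_sets_lebesgue B) auto
  then have "(\<lambda>x. x powr a) -` B \<inter> {0<..} \<in> sets lebesgue"
    using powr_vimage_pos_eq_image[OF assms B(2)] by simp
  then show "(\<lambda>x. x powr a) -` B \<inter> space leb_pos \<in> sets leb_pos"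
    by (auto simp: sets_restrict_space_iff)
qed auto

section \<open>The push-forward of the weighted measure\<close>

text \<open>Change of variables with the constant integrand 1: integrating the derivative of the
  power over the preimage of \<open>B\<close> gives the measure of \<open>B\<close>. Finite measure
  makes the constant 1 absolutely integrable on \<open>B\<close>.\<close>

lemma emeasure_weighted_powr_vimage:
  assumes "\<alpha> > 0" "B \<in> sets leb_pos" "emeasure leb_pos B < \<infinity>"
  shows "emeasure (weighted \<alpha>) ((\<lambda>x. x powr \<alpha>) -` B \<inter> {0<..}) = ennreal (1 / \<alpha>) * emeasure leb_pos B"
proof -
  define S where "S = (\<lambda>x. x powr \<alpha>) -` B \<inter> {0<..}"
  have B: "B \<in> sets lebesgue" "B \<subseteq> {0<..}"
    using assms by (auto simp: sets_restrict_space_iff)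
  have S_pos: "S \<in> sets leb_pos"
    using powr_measurable_leb_pos[of \<alpha>, THEN measurable_sets, of B] assms by (simp add: S_def)
  then have S: "S \<in> sets lebesgue" "S \<subseteq> {0<..}"
    by (auto simp: sets_restrict_space_iff)
  have img: "(\<lambda>x. x powr \<alpha>) ` S = B"
    unfolding S_def using powr_vimage_pos_eq_image[of \<alpha> B] assms B
    by (force simp: image_image powr_powr)
  have em: "emeasure leb_pos B = emeasure lebesgue B"
    using B by (intro emeasure_restrict_space) auto
  have Bl: "B \<in> lmeasurable"
    using assms B em by (auto simp: fmeasurable_def)
  \<comment> \<open>The trailing factor 1 is the constant integrand composed with the power map,
    kept so that the expression matches the change of variables rule.\<close>
  have "(\<lambda>x. \<bar>\<alpha> * x powr (\<alpha> - 1)\<bar> * 1) absolutely_integrable_on S \<and>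
        integral S (\<lambda>x. \<bar>\<alpha> * x powr (\<alpha> - 1)\<bar> * 1) = measure lebesgue B"
  proof (subst has_absolute_integral_change_of_variables_1'[OF S(1), where g = "\<lambda>x. x powr \<alpha>"])
    show "inj_on (\<lambda>x. x powr \<alpha>) S"
      using inj_on_powr_pos[of \<alpha>] assms S by (auto intro: inj_on_subset)
    show "((\<lambda>x. x powr \<alpha>) has_real_derivative \<alpha> * x powr (\<alpha> - 1)) (at x within S)" if "x \<in> S" for x
      using that S by (auto intro: has_field_derivative_at_within[OF has_real_derivative_powr])
    show "(\<lambda>_. 1::real) absolutely_integrable_on (\<lambda>x. x powr \<alpha>) ` S \<and>
          integral ((\<lambda>x. x powr \<alpha>) ` S) (\<lambda>_. 1) = measure lebesgue B"
      using Bl by (simp add: img lmeasure_integral lmeasurable_iff_integrable_on absolutely_integrable_on_iff_nonneg)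
  qed
  then have ai: "set_integrable lebesgue S (\<lambda>x. \<alpha> * x powr (\<alpha> - 1))"
    and int: "integral S (\<lambda>x. \<alpha> * x powr (\<alpha> - 1)) = measure lebesgue B"
    using assms by (simp_all add: abs_mult)
  have lint: "(LINT x:S|lebesgue. \<alpha> * x powr (\<alpha> - 1)) = measure lebesgue B"
    using set_lebesgue_integral_eq_integral(2)[OF ai] int by (rule trans)
  \<comment> \<open>The factor \<alpha> turns the weight into the exact derivative of the power map,
    so the integral computed above applies. It is cancelled against 1/\<alpha> at the end.\<close>
  have "ennreal \<alpha> * emeasure (weighted \<alpha>) S
      = ennreal \<alpha> * (\<integral>\<^sup>+x. ennreal (x powr (\<alpha> - 1)) * indicator S x \<partial>leb_pos)"
    unfolding weighted_def using S_pos
    by (intro arg_cong2[where f = "(*)"] refl emeasure_density) (measurable, auto)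
  also have "\<dots> = ennreal \<alpha> * (\<integral>\<^sup>+x. ennreal (x powr (\<alpha> - 1)) * indicator S x \<partial>lebesgue)"
  proof -
    have "(\<integral>\<^sup>+x. ennreal (x powr (\<alpha> - 1)) * indicator S x * indicator {0<..} x \<partial>lebesgue)
        = (\<integral>\<^sup>+x. ennreal (x powr (\<alpha> - 1)) * indicator S x \<partial>lebesgue)"
      using S(2) by (intro nn_integral_cong) (auto split: split_indicator)
    then show ?thesis
      by (simp add: nn_integral_restrict_space)
  qed
  also have "\<dots> = (\<integral>\<^sup>+x. ennreal \<alpha> * (ennreal (x powr (\<alpha> - 1)) * indicator S x) \<partial>lebesgue)"
  proof (rule nn_integral_cmult[symmetric])
    have "S \<in> sets lebesgue" by fact
    moreover have "(\<lambda>x::real. x powr (\<alpha> - 1)) \<in> borel_measurable lebesgue"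
      by (intro measurable_completion) simp
    ultimately show "(\<lambda>x. ennreal (x powr (\<alpha> - 1)) * indicator S x) \<in> borel_measurable lebesgue"
      by measurable
  qed
  also have "\<dots> = (\<integral>\<^sup>+x. ennreal (indicator S x *\<^sub>R (\<alpha> * x powr (\<alpha> - 1))) \<partial>lebesgue)"
    using assms by (intro nn_integral_cong) (auto simp: ennreal_mult split: split_indicator)
  also have "\<dots> = ennreal (LINT x:S|lebesgue. \<alpha> * x powr (\<alpha> - 1))"
    using ai assms unfolding set_lebesgue_integral_def set_integrable_def
    by (intro nn_integral_eq_integral) auto
  also have "\<dots> = emeasure leb_pos B"
    unfolding lint using Bl em by (simp add: emeasure_eq_measure2)
  finally have "ennreal (1 / \<alpha>) * emeasure leb_pos B
      = ennreal (1 / \<alpha>) * ennreal \<alpha> * emeasure (weighted \<alpha>) S"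
    by (simp add: mult.assoc)
  also have "\<dots> = emeasure (weighted \<alpha>) S"
    using assms by (simp flip: ennreal_mult)
  finally show ?thesis
    by (simp add: S_def)
qed

lemma powr_measurable_weighted:
  "\<alpha> \<noteq> 0 \<Longrightarrow> (\<lambda>x. x powr \<alpha>) \<in> measurable (weighted \<beta>) leb_pos"
  using powr_measurable_leb_pos[of \<alpha>] by (simp add: measurable_def)

text \<open>The previous lemma covers sets of finite measure. A general \<open>B\<close> is
  exhausted by its bounded pieces \<open>C n\<close>, and continuity from below carries the equality
  to the union.\<close>

lemma distr_weighted_powr:
  assumes "\<alpha> > 0"
  shows "distr (weighted \<alpha>) leb_pos (\<lambda>x. x powr \<alpha>) = density leb_pos (\<lambda>_. ennreal (1 / \<alpha>))"
proof (rule measure_eqI)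
  have meas: "(\<lambda>x. x powr \<alpha>) \<in> measurable (weighted \<alpha>) leb_pos"
    using assms by (intro powr_measurable_weighted) auto
  fix B assume "B \<in> sets (distr (weighted \<alpha>) leb_pos (\<lambda>x. x powr \<alpha>))"
  then have B: "B \<in> sets leb_pos" by simp
  then have B': "B \<in> sets lebesgue" "B \<subseteq> {0<..}"
    by (auto simp: sets_restrict_space_iff)
  define C where "C n = B \<inter> {..real n}" for n
  have C: "C n \<in> sets leb_pos" for n
    using B' by (auto simp: C_def sets_restrict_space_iff)
  have fin: "emeasure leb_pos (C n) < \<infinity>" for n
  proof -
    have "emeasure leb_pos (C n) = emeasure lebesgue (C n)"
      using B' by (intro emeasure_restrict_space) (auto simp: C_def)
    also have "\<dots> \<le> emeasure lebesgue {0..real n}"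
      using B' by (intro emeasure_mono) (auto simp: C_def)
    also have "\<dots> < \<infinity>"
      by simp
    finally show ?thesis .
  qed
  have UC: "(\<Union>n. C n) = B"
    using real_arch_simple by (auto simp: C_def)
  have mono: "incseq C"
    by (auto simp: incseq_def C_def intro: order_trans)
  have eq: "emeasure (distr (weighted \<alpha>) leb_pos (\<lambda>x. x powr \<alpha>)) (C n)
      = emeasure (density leb_pos (\<lambda>_. ennreal (1 / \<alpha>))) (C n)" for n
    using emeasure_weighted_powr_vimage[OF assms C fin] C meas
    by (simp add: emeasure_distr emeasure_density_const)
  show "emeasure (distr (weighted \<alpha>) leb_pos (\<lambda>x. x powr \<alpha>)) B
      = emeasure (density leb_pos (\<lambda>_. ennreal (1 / \<alpha>))) B"
    using SUP_emeasure_incseq[of C "distr (weighted \<alpha>) leb_pos (\<lambda>x. x powr \<alpha>)"]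
      SUP_emeasure_incseq[of C "density leb_pos (\<lambda>_. ennreal (1 / \<alpha>))"] C mono
    by (simp add: eq UC image_subset_iff)
qed simp

section \<open>Transfer of null sets, integrability and integrals\<close>

text \<open>A positive constant density leaves the null sets unchanged, so almost-everywhere
  statements pass through the push-forward identity.\<close>

lemma AE_weighted_powr_iff:
  assumes "\<alpha> > 0" "{x \<in> {0<..}. P x} \<in> sets leb_pos"
  shows "(AE x in weighted \<alpha>. P (x powr \<alpha>)) \<longleftrightarrow> (AE x in leb_pos. P x)"
proof -
  have "(AE x in weighted \<alpha>. P (x powr \<alpha>))
      \<longleftrightarrow> (AE x in density leb_pos (\<lambda>_. ennreal (1 / \<alpha>)). P x)"
    using AE_distr_iff[OF powr_measurable_weighted, of \<alpha> P \<alpha>] assms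
    unfolding distr_weighted_powr[OF assms(1)] by simp
  also have "\<dots> \<longleftrightarrow> (AE x in leb_pos. P x)"
    using assms by (subst AE_density) auto
  finally show ?thesis .
qed

lemma integrable_weighted_powr_iff:
  fixes h :: "real \<Rightarrow> 'b::{banach, second_countable_topology}"
  assumes "\<alpha> > 0" "h \<in> borel_measurable leb_pos"
  shows "integrable (weighted \<alpha>) (\<lambda>x. h (x powr \<alpha>)) \<longleftrightarrow> integrable leb_pos h"
proof -
  have "integrable (weighted \<alpha>) (\<lambda>x. h (x powr \<alpha>))
      \<longleftrightarrow> integrable (density leb_pos (\<lambda>_. ennreal (1 / \<alpha>))) h"
    using integrable_distr_eq[OF powr_measurable_weighted assms(2), of \<alpha> \<alpha>] assms
    by (simp add: distr_weighted_powr)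
  also have "\<dots> \<longleftrightarrow> integrable leb_pos h"
    \<comment> \<open>Scaling by \<alpha> removes the density constant and so recovers integrability
      of \<open>h\<close> from that of its multiple.\<close>
    using assms integrable_scaleR_right[of \<alpha> leb_pos "\<lambda>x. (1 / \<alpha>) *\<^sub>R h x"]
    by (subst integrable_density) auto
  finally show ?thesis .
qed

lemma integral_weighted_powr:
  fixes h :: "real \<Rightarrow> 'b::{banach, second_countable_topology}"
  assumes "\<alpha> > 0" "h \<in> borel_measurable leb_pos"
  shows "(\<integral>x. h (x powr \<alpha>) \<partial>weighted \<alpha>) = (1 / \<alpha>) *\<^sub>R (\<integral>x. h x \<partial>leb_pos)"
proof -
  have "(\<integral>x. h (x powr \<alpha>) \<partial>weighted \<alpha>) = integral\<^sup>L (density leb_pos (\<lambda>_. ennreal (1 / \<alpha>))) h"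
    using integral_distr[OF powr_measurable_weighted assms(2), of \<alpha> \<alpha>] assms
    by (simp add: distr_weighted_powr)
  also have "\<dots> = (1 / \<alpha>) *\<^sub>R (\<integral>x. h x \<partial>leb_pos)"
    using assms by (subst integral_density) auto
  finally show ?thesis .
qed

section \<open>Computing with classes through representatives\<close>

lemma borel_measurable_cnj [measurable]: "cnj \<in> borel_measurable borel"
  by (intro borel_measurable_continuous_onI continuous_intros)

lemma Lp_class_eq_iff:
  assumes "f \<in> Lp_fun p M" "g \<in> Lp_fun p M"
  shows "Lp_class p M f = Lp_class p M g \<longleftrightarrow> (AE x in M. f x = g x)"
  using eq_equiv_class_iff[OF equiv_ae_eq assms] assms by (simp add: ae_eq_def)

lemma Lp_class_in_Lp: "f \<in> Lp_fun p M \<Longrightarrow> Lp_class p M f \<in> Lp p M"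
  unfolding Lp_def by (rule quotientI)

lemma LpE:
  assumes "F \<in> Lp p M"
  obtains f where "f \<in> Lp_fun p M" "F = Lp_class p M f"
  using assms unfolding Lp_def by (rule quotientE)

text \<open>Lifted operations are unions over all representatives. If every representative yields
  the same set, the union collapses to that set, because the class is nonempty.\<close>

lemma UN_Lp_class:
  assumes "f \<in> Lp_fun p M" "\<And>g. g \<in> Lp_class p M f \<Longrightarrow> A g = A f"
  shows "(\<Union>g\<in>Lp_class p M f. A g) = A f"
proof -
  have "f \<in> Lp_class p M f"
    using assms(1) by (simp add: ae_eq_def)
  then show ?thesis
    using assms(2) by blast
qed

lemma Lp_fun_scale:
  assumes "f \<in> Lp_fun p M"
  shows "(\<lambda>x. c * f x) \<in> Lp_fun p M"
  using assms by (auto simp: Lp_fun_def norm_mult powr_mult)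

text \<open>The sum is dominated pointwise: |f + g| is at most twice the larger modulus, and the
  p-th power of a maximum is at most the sum of the p-th powers.\<close>

lemma Lp_fun_add:
  assumes "f \<in> Lp_fun p M" "g \<in> Lp_fun p M" "p \<ge> 0"
  shows "(\<lambda>x. f x + g x) \<in> Lp_fun p M"
proof -
  have [measurable]: "f \<in> borel_measurable M" "g \<in> borel_measurable M"
    using assms by (auto simp: Lp_fun_def)
  have "integrable M (\<lambda>x. 2 powr p * (cmod (f x) powr p + cmod (g x) powr p))"
    using assms by (auto simp: Lp_fun_def)
  then have "integrable M (\<lambda>x. cmod (f x + g x) powr p)"
  proof (rule Bochner_Integration.integrable_bound)
    show "AE x in M. norm (cmod (f x + g x) powr p)
        \<le> norm (2 powr p * (cmod (f x) powr p + cmod (g x) powr p))"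
    proof (rule AE_I2)
      fix x
      let ?m = "max (cmod (f x)) (cmod (g x))"
      have "cmod (f x + g x) \<le> 2 * ?m"
        using norm_triangle_ineq[of "f x" "g x"] by linarith
      then have "cmod (f x + g x) powr p \<le> (2 * ?m) powr p"
        using assms by (intro powr_mono2) auto
      also have "\<dots> = 2 powr p * ?m powr p"
        by (simp add: powr_mult)
      also have "\<dots> \<le> 2 powr p * (cmod (f x) powr p + cmod (g x) powr p)"
        by (intro mult_left_mono) (auto simp: max_def)
      finally show "norm (cmod (f x + g x) powr p)
          \<le> norm (2 powr p * (cmod (f x) powr p + cmod (g x) powr p))"
        by simp
    qed
  qed measurable
  then show ?thesis
    by (simp add: Lp_fun_def)
qed

lemma Lp_add_class:
  assumes "f \<in> Lp_fun p M" "g \<in> Lp_fun p M" "p \<ge> 0"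
  shows "Lp_add p M (Lp_class p M f) (Lp_class p M g) = Lp_class p M (\<lambda>x. f x + g x)"
proof -
  have "Lp_class p M (\<lambda>x. f' x + g' x) = Lp_class p M (\<lambda>x. f x + g x)"
    if "f' \<in> Lp_class p M f" "g' \<in> Lp_class p M g" for f' g'
    using that assms by (subst Lp_class_eq_iff) (auto simp: ae_eq_def intro: Lp_fun_add)
  moreover have "f \<in> Lp_class p M f" "g \<in> Lp_class p M g"
    using assms by (simp_all add: ae_eq_def)
  ultimately show ?thesis
    unfolding Lp_add_def by blast
qed

lemma Lp_scale_class:
  assumes "f \<in> Lp_fun p M"
  shows "Lp_scale p M c (Lp_class p M f) = Lp_class p M (\<lambda>x. c * f x)"
  unfolding Lp_scale_def using assms
proof (rule UN_Lp_class)
  fix g assume "g \<in> Lp_class p M f"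
  then have "g \<in> Lp_fun p M" "AE x in M. f x = g x"
    by (auto simp: ae_eq_def)
  moreover from this(2) have "AE x in M. c * g x = c * f x"
    by (rule eventually_mono) simp
  ultimately show "Lp_class p M (\<lambda>x. c * g x) = Lp_class p M (\<lambda>x. c * f x)"
    using assms by (simp only: Lp_class_eq_iff Lp_fun_scale)
qed

text \<open>Representatives agree almost everywhere and hence have equal integrals. The image under
  \<open>the_elem\<close> is therefore a singleton, which gives \<open>Lp_norm\<close> its intended
  value.\<close>

lemma Lp_norm_class:
  assumes "f \<in> Lp_fun p M"
  shows "Lp_norm p M (Lp_class p M f) = (\<integral>x. cmod (f x) powr p \<partial>M) powr (1 / p)"
proof -
  have eq: "(\<integral>x. cmod (g x) powr p \<partial>M) = (\<integral>x. cmod (f x) powr p \<partial>M)"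
    if "g \<in> Lp_class p M f" for g
  proof -
    from that have [measurable]: "f \<in> borel_measurable M" "g \<in> borel_measurable M"
      and "AE x in M. f x = g x"
      by (auto simp: ae_eq_def Lp_fun_def)
    then show ?thesis
      by (intro integral_cong_AE) auto
  qed
  have "(\<lambda>f. (\<integral>x. cmod (f x) powr p \<partial>M) powr (1 / p)) ` Lp_class p M f
      = (\<lambda>_. (\<integral>x. cmod (f x) powr p \<partial>M) powr (1 / p)) ` Lp_class p M f"
    by (rule image_cong[OF refl]) (simp only: eq)
  also have "\<dots> = {(\<integral>x. cmod (f x) powr p \<partial>M) powr (1 / p)}"
    using assms by (intro image_constant[of f]) (simp add: ae_eq_def)
  finally show ?thesis
    by (simp add: Lp_norm_def)
qed

text \<open>As for the norm, the integral is constant on all pairs of representatives, so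
  \<open>the_elem\<close> is applied to a singleton.\<close>

lemma L2_inner_class:
  assumes "f \<in> Lp_fun 2 M" "g \<in> Lp_fun 2 M"
  shows "L2_inner M (Lp_class 2 M f) (Lp_class 2 M g) = (\<integral>x. f x * cnj (g x) \<partial>M)"
proof -
  have "(\<integral>x. f' x * cnj (g' x) \<partial>M) = (\<integral>x. f x * cnj (g x) \<partial>M)"
    if "f' \<in> Lp_class 2 M f" "g' \<in> Lp_class 2 M g" for f' g'
  proof -
    from that have [measurable]: "f \<in> borel_measurable M" "f' \<in> borel_measurable M"
        "g \<in> borel_measurable M" "g' \<in> borel_measurable M"
      and "AE x in M. f x = f' x" "AE x in M. g x = g' x"
      by (auto simp: ae_eq_def Lp_fun_def)
    then show ?thesis
      by (intro integral_cong_AE) auto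
  qed
  moreover have "f \<in> Lp_class 2 M f" "g \<in> Lp_class 2 M g"
    using assms by (simp_all add: ae_eq_def)
  ultimately have "(\<lambda>(f, g). \<integral>x. f x * cnj (g x) \<partial>M) ` (Lp_class 2 M f \<times> Lp_class 2 M g)
      = {\<integral>x. f x * cnj (g x) \<partial>M}"
    by (force simp del: Image_singleton_iff)
  then show ?thesis
    by (simp add: L2_inner_def)
qed

section \<open>The operator and its inverse on functions\<close>

text \<open>The transfer lemmas evaluate functions at \<open>x powr \<alpha>\<close>. At such points
  the root inside \<open>U_fun\<close> cancels and only the constant factor remains.\<close>

lemma U_fun_powr:
  assumes "\<alpha> > 0" "x > 0"
  shows "U_fun p \<alpha> f (x powr \<alpha>) = complex_of_real (\<alpha> powr (- 1 / p)) * f x"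
  using assms by (simp add: U_fun_def powr_powr)

text \<open>This one-sided identity yields both that \<open>U_inv_fun\<close> lands in the weighted
  space and that \<open>U\<close> is surjective. Together with injectivity of \<open>U\<close> it
  identifies the inverse.\<close>

lemma U_fun_U_inv_fun:
  assumes "\<alpha> > 0" "x > 0"
  shows "U_fun p \<alpha> (U_inv_fun p \<alpha> g) x = g x"
proof -
  have "complex_of_real (\<alpha> powr (- 1 / p)) * complex_of_real (\<alpha> powr (1 / p)) = 1"
    using assms by (simp flip: of_real_mult powr_add)
  then show ?thesis
    using assms by (simp add: U_inv_fun_def U_fun_def powr_powr)
qed

text \<open>The p-th power of the normalising factor is 1/\<alpha>, exactly the constant produced by
  the push-forward.\<close>

lemma cmod_U_fun_powr:
  assumes "\<alpha> > 0" "x > 0" "p \<noteq> 0"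
  shows "cmod (U_fun p \<alpha> f (x powr \<alpha>)) powr p = cmod (f x) powr p / \<alpha>"
proof -
  have "(\<alpha> powr (- 1 / p)) powr p = 1 / \<alpha>"
    using assms by (simp only: powr_powr) (simp add: powr_minus_divide)
  then show ?thesis
    unfolding U_fun_powr[OF assms(1,2)] norm_mult norm_of_real by (simp add: powr_mult)
qed

text \<open>Since \<open>f\<close> is only Lebesgue measurable, the composition relies on the root
  being measurable from Lebesgue sets to Lebesgue sets.\<close>

lemma U_fun_measurable:
  assumes "\<alpha> > 0" "f \<in> borel_measurable (weighted \<alpha>)"
  shows "U_fun p \<alpha> f \<in> borel_measurable leb_pos"
proof -
  have "f \<in> borel_measurable leb_pos"
    using assms(2) by (simp cong: measurable_cong_sets)
  then have "(\<lambda>x. f (x powr (1 / \<alpha>))) \<in> borel_measurable leb_pos"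
    using powr_measurable_leb_pos[of "1 / \<alpha>"] assms by (auto intro: measurable_compose[where g = f])
  then show ?thesis
    unfolding U_fun_def by measurable
qed

lemma U_inv_fun_measurable:
  assumes "\<alpha> > 0" "g \<in> borel_measurable leb_pos"
  shows "U_inv_fun p \<alpha> g \<in> borel_measurable (weighted \<alpha>)"
proof -
  have "(\<lambda>x. g (x powr \<alpha>)) \<in> borel_measurable (weighted \<alpha>)"
    using powr_measurable_weighted[of \<alpha>] assms by (auto intro: measurable_compose[where g = g])
  then show ?thesis
    unfolding U_inv_fun_def by measurable
qed

text \<open>The equivalence serves twice: right to left it shows that \<open>U_fun\<close> maps into
  the target space, and left to right it gives membership for \<open>U_inv_fun\<close>.\<close>

lemma U_fun_in_Lp_fun_iff:
  assumes "\<alpha> > 0" "p \<noteq> 0" "f \<in> borel_measurable (weighted \<alpha>)"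
  shows "U_fun p \<alpha> f \<in> Lp_fun p leb_pos \<longleftrightarrow> f \<in> Lp_fun p (weighted \<alpha>)"
proof -
  note [measurable] = U_fun_measurable[OF assms(1,3), of p]
  have "integrable leb_pos (\<lambda>\<xi>. cmod (U_fun p \<alpha> f \<xi>) powr p)
      \<longleftrightarrow> integrable (weighted \<alpha>) (\<lambda>x. cmod (U_fun p \<alpha> f (x powr \<alpha>)) powr p)"
    using assms by (intro integrable_weighted_powr_iff[symmetric]) measurable
  also have "\<dots> \<longleftrightarrow> integrable (weighted \<alpha>) (\<lambda>x. cmod (f x) powr p / \<alpha>)"
    using assms by (intro Bochner_Integration.integrable_cong) (auto simp: cmod_U_fun_powr)
  also have "\<dots> \<longleftrightarrow> integrable (weighted \<alpha>) (\<lambda>x. cmod (f x) powr p)"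
    using assms by (simp add: divide_inverse mult.commute[of _ "inverse \<alpha>"])
  finally show ?thesis
    using assms by (simp add: Lp_fun_def U_fun_measurable)
qed

lemma U_fun_in_Lp_fun:
  assumes "\<alpha> > 0" "p \<noteq> 0" "f \<in> Lp_fun p (weighted \<alpha>)"
  shows "U_fun p \<alpha> f \<in> Lp_fun p leb_pos"
  using assms U_fun_in_Lp_fun_iff[of \<alpha> p f] by (auto simp: Lp_fun_def)

text \<open>Applying \<open>U_fun\<close> to \<open>U_inv_fun p \<alpha> g\<close> returns
  \<open>g\<close> on the half-line, so membership of \<open>g\<close> is pulled back through the
  preceding equivalence.\<close>

lemma U_inv_fun_in_Lp_fun:
  assumes "\<alpha> > 0" "p \<noteq> 0" "g \<in> Lp_fun p leb_pos"
  shows "U_inv_fun p \<alpha> g \<in> Lp_fun p (weighted \<alpha>)"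
proof -
  have meas: "g \<in> borel_measurable leb_pos"
    using assms by (simp add: Lp_fun_def)
  have "U_fun p \<alpha> (U_inv_fun p \<alpha> g) \<in> borel_measurable leb_pos"
    using assms(1) meas by (intro U_fun_measurable U_inv_fun_measurable)
  moreover have "integrable leb_pos (\<lambda>x. cmod (U_fun p \<alpha> (U_inv_fun p \<alpha> g) x) powr p)
      \<longleftrightarrow> integrable leb_pos (\<lambda>x. cmod (g x) powr p)"
    using assms by (intro Bochner_Integration.integrable_cong) (auto simp: U_fun_U_inv_fun)
  ultimately have "U_fun p \<alpha> (U_inv_fun p \<alpha> g) \<in> Lp_fun p leb_pos"
    using assms by (simp add: Lp_fun_def)
  then show ?thesis
    using assms meas by (simp add: U_fun_in_Lp_fun_iff U_inv_fun_measurable)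
qed

text \<open>Right to left this makes \<open>U\<close> well defined on classes; left to right it
  makes \<open>U\<close> injective.\<close>

lemma AE_U_fun_eq_iff:
  assumes "\<alpha> > 0" "f \<in> Lp_fun p (weighted \<alpha>)" "g \<in> Lp_fun p (weighted \<alpha>)"
  shows "(AE \<xi> in leb_pos. U_fun p \<alpha> f \<xi> = U_fun p \<alpha> g \<xi>) \<longleftrightarrow> (AE x in weighted \<alpha>. f x = g x)"
proof -
  have [measurable]: "U_fun p \<alpha> f \<in> borel_measurable leb_pos" "U_fun p \<alpha> g \<in> borel_measurable leb_pos"
    using assms by (auto simp: Lp_fun_def intro: U_fun_measurable)
  have "{\<xi> \<in> space leb_pos. U_fun p \<alpha> f \<xi> = U_fun p \<alpha> g \<xi>} \<in> sets leb_pos"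
    by measurable
  then have "(AE \<xi> in leb_pos. U_fun p \<alpha> f \<xi> = U_fun p \<alpha> g \<xi>)
      \<longleftrightarrow> (AE x in weighted \<alpha>. U_fun p \<alpha> f (x powr \<alpha>) = U_fun p \<alpha> g (x powr \<alpha>))"
    using assms by (intro AE_weighted_powr_iff[symmetric]) auto
  also have "\<dots> \<longleftrightarrow> (AE x in weighted \<alpha>. f x = g x)"
    using assms by (intro AE_cong) (auto simp: U_fun_powr)
  finally show ?thesis .
qed

section \<open>The operator on classes: linearity, bijectivity, inverse\<close>

lemma U_class:
  assumes "\<alpha> > 0" "p \<noteq> 0" "f \<in> Lp_fun p (weighted \<alpha>)"
  shows "U p \<alpha> (Lp_class p (weighted \<alpha>) f) = Lp_class p leb_pos (U_fun p \<alpha> f)"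
  unfolding U_def
proof (rule UN_Lp_class[OF assms(3)])
  fix g assume "g \<in> Lp_class p (weighted \<alpha>) f"
  then have g: "g \<in> Lp_fun p (weighted \<alpha>)" and "AE x in weighted \<alpha>. f x = g x"
    by (auto simp: ae_eq_def)
  then have "AE \<xi> in leb_pos. U_fun p \<alpha> f \<xi> = U_fun p \<alpha> g \<xi>"
    using AE_U_fun_eq_iff[OF assms(1,3) g] by simp
  then have "Lp_class p leb_pos (U_fun p \<alpha> f) = Lp_class p leb_pos (U_fun p \<alpha> g)"
    using Lp_class_eq_iff[OF U_fun_in_Lp_fun[OF assms] U_fun_in_Lp_fun[OF assms(1,2) g]] by simp
  then show "Lp_class p leb_pos (U_fun p \<alpha> g) = Lp_class p leb_pos (U_fun p \<alpha> f)" ..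
qed

lemma U_linear:
  assumes "\<alpha> > 0" "p > 0"
  shows "Lp_linear p (weighted \<alpha>) leb_pos (U p \<alpha>)"
proof -
  have mem: "U_fun p \<alpha> f \<in> Lp_fun p leb_pos" if "f \<in> Lp_fun p (weighted \<alpha>)" for f
    using that assms by (intro U_fun_in_Lp_fun) auto
  show ?thesis
    unfolding Lp_linear_def
  proof (intro conjI ballI allI)
    fix F assume "F \<in> Lp p (weighted \<alpha>)"
    then obtain f where f: "f \<in> Lp_fun p (weighted \<alpha>)" "F = Lp_class p (weighted \<alpha>) f"
      by (rule LpE)
    show "U p \<alpha> F \<in> Lp p leb_pos"
      using assms f mem[OF f(1)] by (simp add: U_class Lp_class_in_Lp)
    show "U p \<alpha> (Lp_scale p (weighted \<alpha>) c F) = Lp_scale p leb_pos c (U p \<alpha> F)" for c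
      using assms f(1) mem[OF f(1)] Lp_fun_scale[OF f(1), of c] unfolding f(2)
      \<comment> \<open>\<open>U_fun\<close> stays folded while the class lemmas are applied, so
        that their membership premises match the given facts. Unfolding it afterwards leaves a
        pointwise identity.\<close>
      by (simp add: U_class Lp_scale_class) (simp add: U_fun_def algebra_simps)
    fix G assume "G \<in> Lp p (weighted \<alpha>)"
    then obtain g where g: "g \<in> Lp_fun p (weighted \<alpha>)" "G = Lp_class p (weighted \<alpha>) g"
      by (rule LpE)
    show "U p \<alpha> (Lp_add p (weighted \<alpha>) F G) = Lp_add p leb_pos (U p \<alpha> F) (U p \<alpha> G)"
      using assms f(1) g(1) mem[OF f(1)] mem[OF g(1)] Lp_fun_add[OF f(1) g(1)] unfolding f(2) g(2)
      by (simp add: U_class Lp_add_class) (simp add: U_fun_def algebra_simps)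
  qed
qed

lemma U_U_inv_class:
  assumes "\<alpha> > 0" "p \<noteq> 0" "g \<in> Lp_fun p leb_pos"
  shows "U p \<alpha> (Lp_class p (weighted \<alpha>) (U_inv_fun p \<alpha> g)) = Lp_class p leb_pos g"
proof -
  have inv: "U_inv_fun p \<alpha> g \<in> Lp_fun p (weighted \<alpha>)"
    using assms by (rule U_inv_fun_in_Lp_fun)
  have "AE x in leb_pos. U_fun p \<alpha> (U_inv_fun p \<alpha> g) x = g x"
    using assms by (intro AE_I2) (auto simp: U_fun_U_inv_fun)
  then show ?thesis
    using Lp_class_eq_iff[OF U_fun_in_Lp_fun[OF assms(1,2) inv] assms(3)]
      U_class[OF assms(1,2) inv] by simp
qed

lemma U_bij_betw:
  assumes "\<alpha> > 0" "p \<noteq> 0"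
  shows "bij_betw (U p \<alpha>) (Lp p (weighted \<alpha>)) (Lp p leb_pos)"
proof -
  have mem: "U_fun p \<alpha> f \<in> Lp_fun p leb_pos" if "f \<in> Lp_fun p (weighted \<alpha>)" for f
    using that assms by (intro U_fun_in_Lp_fun) auto
  have "inj_on (U p \<alpha>) (Lp p (weighted \<alpha>))"
  proof (rule inj_onI)
    fix F G assume "F \<in> Lp p (weighted \<alpha>)" "G \<in> Lp p (weighted \<alpha>)" and eq: "U p \<alpha> F = U p \<alpha> G"
    then obtain f g where fg: "f \<in> Lp_fun p (weighted \<alpha>)" "F = Lp_class p (weighted \<alpha>) f"
        "g \<in> Lp_fun p (weighted \<alpha>)" "G = Lp_class p (weighted \<alpha>) g"
      by (metis LpE)
    have "AE \<xi> in leb_pos. U_fun p \<alpha> f \<xi> = U_fun p \<alpha> g \<xi>"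
      using eq Lp_class_eq_iff[OF mem[OF fg(1)] mem[OF fg(3)]]
        U_class[OF assms fg(1)] U_class[OF assms fg(3)] fg(2,4) by simp
    then show "F = G"
      using AE_U_fun_eq_iff[OF assms(1) fg(1,3)] Lp_class_eq_iff[OF fg(1,3)] fg(2,4) by simp
  qed
  moreover have "U p \<alpha> ` Lp p (weighted \<alpha>) = Lp p leb_pos"
  proof (intro equalityI subsetI)
    fix G assume "G \<in> U p \<alpha> ` Lp p (weighted \<alpha>)"
    then obtain f where f: "f \<in> Lp_fun p (weighted \<alpha>)" "G = U p \<alpha> (Lp_class p (weighted \<alpha>) f)"
      by (metis LpE imageE)
    then show "G \<in> Lp p leb_pos"
      using assms mem[OF f(1)] by (simp add: U_class Lp_class_in_Lp)
  next
    fix G assume "G \<in> Lp p leb_pos"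
    then obtain g where g: "g \<in> Lp_fun p leb_pos" "G = Lp_class p leb_pos g"
      by (rule LpE)
    then show "G \<in> U p \<alpha> ` Lp p (weighted \<alpha>)"
      using assms U_U_inv_class[of \<alpha> p g]
      by (metis U_inv_fun_in_Lp_fun Lp_class_in_Lp imageI)
  qed
  ultimately show ?thesis
    by (simp add: bij_betw_def)
qed

text \<open>By injectivity on \<open>Lp p (weighted \<alpha>)\<close>, \<open>inv_into\<close> must
  return any preimage exhibited there, and \<open>U_inv_fun\<close> supplies one.\<close>

lemma inv_into_U_class:
  assumes "\<alpha> > 0" "p \<noteq> 0" "g \<in> Lp_fun p leb_pos"
  shows "inv_into (Lp p (weighted \<alpha>)) (U p \<alpha>) (Lp_class p leb_pos g)
    = Lp_class p (weighted \<alpha>) (U_inv_fun p \<alpha> g)"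
proof (rule inv_into_f_eq)
  show "inj_on (U p \<alpha>) (Lp p (weighted \<alpha>))"
    using U_bij_betw[OF assms(1,2)] by (simp add: bij_betw_def)
  show "Lp_class p (weighted \<alpha>) (U_inv_fun p \<alpha> g) \<in> Lp p (weighted \<alpha>)"
    using assms by (intro Lp_class_in_Lp U_inv_fun_in_Lp_fun)
  show "U p \<alpha> (Lp_class p (weighted \<alpha>) (U_inv_fun p \<alpha> g)) = Lp_class p leb_pos g"
    using assms by (rule U_U_inv_class)
qed

section \<open>Preservation of the norm and of the inner product\<close>

text \<open>Pulling back to the weighted side puts 1/\<alpha> before the left integral by the
  push-forward and inside the right one by the normalising factor; the two cancel.\<close>

lemma integral_cmod_U_fun:
  assumes "\<alpha> > 0" "p \<noteq> 0" "f \<in> borel_measurable (weighted \<alpha>)"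
  shows "(\<integral>\<xi>. cmod (U_fun p \<alpha> f \<xi>) powr p \<partial>leb_pos) = (\<integral>x. cmod (f x) powr p \<partial>weighted \<alpha>)"
proof -
  note [measurable] = U_fun_measurable[OF assms(1,3), of p]
  have "(1 / \<alpha>) *\<^sub>R (\<integral>\<xi>. cmod (U_fun p \<alpha> f \<xi>) powr p \<partial>leb_pos)
      = (\<integral>x. cmod (U_fun p \<alpha> f (x powr \<alpha>)) powr p \<partial>weighted \<alpha>)"
    using assms by (intro integral_weighted_powr[symmetric]) measurable
  also have "\<dots> = (\<integral>x. cmod (f x) powr p / \<alpha> \<partial>weighted \<alpha>)"
    using assms by (intro Bochner_Integration.integral_cong) (auto simp: cmod_U_fun_powr)
  finally show ?thesis
    using assms by simp
qed

lemma integral_U_fun_cnj: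
  assumes "\<alpha> > 0" "f \<in> borel_measurable (weighted \<alpha>)" "g \<in> borel_measurable (weighted \<alpha>)"
  shows "(\<integral>\<xi>. U_fun 2 \<alpha> f \<xi> * cnj (U_fun 2 \<alpha> g \<xi>) \<partial>leb_pos) = (\<integral>x. f x * cnj (g x) \<partial>weighted \<alpha>)"
proof -
  note [measurable] = U_fun_measurable[OF assms(1,2), of 2] U_fun_measurable[OF assms(1,3), of 2]
  have eq: "U_fun 2 \<alpha> f (x powr \<alpha>) * cnj (U_fun 2 \<alpha> g (x powr \<alpha>)) = (1 / \<alpha>) *\<^sub>R (f x * cnj (g x))"
    if "x > 0" for x
  proof -
    \<comment> \<open>For p = 2 each argument of the inner product contributes one normalising
      factor. The factors are real, so conjugation leaves them unchanged, and their product is the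
      push-forward constant.\<close>
    have "\<alpha> powr (- 1 / 2) * \<alpha> powr (- 1 / 2) = 1 / \<alpha>"
      using assms by (simp add: powr_minus_divide flip: powr_add)
    then have "complex_of_real (\<alpha> powr (- 1 / 2)) * complex_of_real (\<alpha> powr (- 1 / 2)) = of_real (1 / \<alpha>)"
      by (simp only: flip: of_real_mult)
    moreover have "U_fun 2 \<alpha> f (x powr \<alpha>) * cnj (U_fun 2 \<alpha> g (x powr \<alpha>))
        = (complex_of_real (\<alpha> powr (- 1 / 2)) * complex_of_real (\<alpha> powr (- 1 / 2))) * (f x * cnj (g x))"
      using assms(1) that by (simp add: U_fun_powr)
    ultimately show ?thesis
      by (simp add: scaleR_conv_of_real)
  qed
  have "(1 / \<alpha>) *\<^sub>R (\<integral>\<xi>. U_fun 2 \<alpha> f \<xi> * cnj (U_fun 2 \<alpha> g \<xi>) \<partial>leb_pos)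
      = (\<integral>x. U_fun 2 \<alpha> f (x powr \<alpha>) * cnj (U_fun 2 \<alpha> g (x powr \<alpha>)) \<partial>weighted \<alpha>)"
    using assms by (intro integral_weighted_powr[symmetric]) measurable
  also have "\<dots> = (\<integral>x. (1 / \<alpha>) *\<^sub>R (f x * cnj (g x)) \<partial>weighted \<alpha>)"
    by (intro Bochner_Integration.integral_cong) (auto simp: eq)
  also have "\<dots> = (1 / \<alpha>) *\<^sub>R (\<integral>x. f x * cnj (g x) \<partial>weighted \<alpha>)"
    by (rule integral_scaleR_right)
  finally show ?thesis
    using assms by simp
qed

theorem proposition7:
  fixes \<alpha> p :: real
  assumes "0 < \<alpha>" and "\<alpha> \<le> 1" and "1 \<le> p"
  shows "(\<forall>f\<in>Lp_fun p (weighted \<alpha>).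
            U_fun p \<alpha> f \<in> Lp_fun p leb_pos \<and>
            U p \<alpha> (Lp_class p (weighted \<alpha>) f) = Lp_class p leb_pos (U_fun p \<alpha> f)) \<and>
         isometric_isomorphism p (weighted \<alpha>) leb_pos (U p \<alpha>) \<and>
         (\<forall>g\<in>Lp_fun p leb_pos.
            U_inv_fun p \<alpha> g \<in> Lp_fun p (weighted \<alpha>) \<and>
            inv_into (Lp p (weighted \<alpha>)) (U p \<alpha>) (Lp_class p leb_pos g) =
              Lp_class p (weighted \<alpha>) (U_inv_fun p \<alpha> g)) \<and>
         (p = 2 \<longrightarrow> unitary (weighted \<alpha>) leb_pos (U p \<alpha>))"
proof -
  have p: "p > 0" "p \<noteq> 0"
    using assms by auto
  have mem: "U_fun p \<alpha> f \<in> Lp_fun p leb_pos" if "f \<in> Lp_fun p (weighted \<alpha>)" for f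
    using that assms p by (intro U_fun_in_Lp_fun) auto
  \<comment> \<open>On a single representative the integrals of the p-th powers already agree,
    before the root 1/p is taken.\<close>
  have "Lp_norm p leb_pos (U p \<alpha> F) = Lp_norm p (weighted \<alpha>) F" if "F \<in> Lp p (weighted \<alpha>)" for F
  proof -
    from that obtain f where f: "f \<in> Lp_fun p (weighted \<alpha>)" "F = Lp_class p (weighted \<alpha>) f"
      by (rule LpE)
    then have "f \<in> borel_measurable (weighted \<alpha>)"
      by (simp add: Lp_fun_def)
    then show ?thesis
      using integral_cmod_U_fun[of \<alpha> p f] assms p f
      by (simp add: U_class Lp_norm_class mem)
  qed
  then have "isometric_isomorphism p (weighted \<alpha>) leb_pos (U p \<alpha>)"
    using assms p by (simp add: isometric_isomorphism_def U_linear U_bij_betw)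
  moreover have "unitary (weighted \<alpha>) leb_pos (U p \<alpha>)" if "p = 2"
  proof -
    have "L2_inner leb_pos (U 2 \<alpha> F) (U 2 \<alpha> G) = L2_inner (weighted \<alpha>) F G"
      if "F \<in> Lp 2 (weighted \<alpha>)" "G \<in> Lp 2 (weighted \<alpha>)" for F G
    proof -
      from that obtain f g where fg: "f \<in> Lp_fun 2 (weighted \<alpha>)" "F = Lp_class 2 (weighted \<alpha>) f"
          "g \<in> Lp_fun 2 (weighted \<alpha>)" "G = Lp_class 2 (weighted \<alpha>) g"
        by (metis LpE)
      then have "f \<in> borel_measurable (weighted \<alpha>)" "g \<in> borel_measurable (weighted \<alpha>)"
        by (simp_all add: Lp_fun_def)
      then show ?thesis
        using assms fg(1,3) mem[unfolded \<open>p = 2\<close>] U_class[of \<alpha> 2]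
        by (simp add: fg(2,4) L2_inner_class integral_U_fun_cnj)
    qed
    then show ?thesis
      using assms p \<open>p = 2\<close> by (simp add: unitary_def U_linear U_bij_betw)
  qed
  ultimately show ?thesis
    using assms p mem by (simp add: U_class U_inv_fun_in_Lp_fun inv_into_U_class)
qed

end
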